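(* Let $q$ be a prime power and $n>2$ an integer. Let $b\in\mathbb{F}_{q^{2n}}^*$ and let $1\leq s\leq 2n-1$ be an integer with $\gcd(s,n)=1$ and $\mathrm{N}_{q^{2n}/q^n}(b)\neq 1$, and suppose that the $\mathbb{F}_q$-subspace $U_{b,s}=\{(x,bx^{q^s}+x^{q^{s+n}})\colon x\in\mathbb{F}_{q^{2n}}\}$ of $\mathbb{F}_{q^{2n}}\times\mathbb{F}_{q^{2n}}$ is scattered. Then the $\mathbb{F}_q$-linear MRD-code of dimension $4n$ and minimum distance $2n-1$ arising from $U_{b,s}$, namely $$\{x\mapsto a_1(bx^{q^s}+x^{q^{s+n}})+a_0x\colon a_0,a_1\in\mathbb{F}_{q^{2n}}\},$$ is not equivalent to any of the previously known $\mathbb{F}_q$-linear MRD-codes with the same parameters $(2n,2n,q;2n-1)$, that is, to any code $$\mathcal{H}_{2,t}(\mu,h)=\{x\mapsto a_0x+a_1x^{q^t}+\mu a_0^{q^h}x^{q^{2t}}\colon a_0,a_1\in\mathbb{F}_{q^{2n}}\},$$ where $t$ and $h$ are non-negative integers, $\gcd(t,2n)=1$, and $\mu\in\mathbb{F}_{q^{2n}}$ satisfies $\mathrm{N}_{q^{2nt}/q^{t}}(\mu)\neq 1$.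
   Context: $\mathrm{N}_{q^{2n}/q^n}(x)=x^{q^n+1}$ is the norm from $\mathbb{F}_{q^{2n}}$ to $\mathbb{F}_{q^n}$, and $\mathrm{N}_{q^{2nt}/q^{t}}$ is the norm from $\mathbb{F}_{q^{2nt}}$ to $\mathbb{F}_{q^t}$. An $\mathbb{F}_q$-subspace $U$ of $\mathbb{F}_{q^m}\times\mathbb{F}_{q^m}$ is scattered if $\dim_{\mathbb{F}_q}(\langle \mathbf{v}\rangle_{\mathbb{F}_{q^m}}\cap U)\leq 1$ for every nonzero $\mathbf{v}\in\mathbb{F}_{q^m}\times\mathbb{F}_{q^m}$. After fixing an $\mathbb{F}_q$-basis of $\mathbb{F}_{q^m}$ (here $m=2n$), sets of $\mathbb{F}_q$-linear maps $\mathbb{F}_{q^m}\to\mathbb{F}_{q^m}$ are identified with subsets (codes) of $\mathbb{F}_q^{m\times m}$. The rank distance is $d(A,B)=\mathrm{rk}(A-B)$ and the minimum distance $d$ of a code is the smallest distance between two distinct elements; a code $\mathcal{C}\subseteq\mathbb{F}_q^{m\times m}$ is an MRD-code if $\#\mathcal{C}=q^{m(m-d+1)}$, and an $\mathbb{F}_q$-linear code in $\mathbb{F}_q^{m\times m}$ with minimum distance $d$ has parameters $(m,m,q;d)$. Two codes $\mathcal{C},\mathcal{C}'\subseteq\mathbb{F}_q^{m\times m}$ are equivalent if and only if there exist invertible matrices $A,B\in\mathbb{F}_q^{m\times m}$ and a field automorphism $\sigma$ of $\mathbb{F}_q$ (applied entrywise) such that $\{AC^{\sigma}B\colon C\in\mathcal{C}\}=\mathcal{C}'$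 or $\{AC^{T\sigma}B\colon C\in\mathcal{C}\}=\mathcal{C}'$, where $T$ denotes transposition. *)

theory Defs
  imports "HOL-Analysis.Analysis" "HOL-Number_Theory.Prime_Powers"
begin

text \<open>
  The field extension is a homomorphism \<open>\<iota>\<close> from a finite field \<open>'k\<close> (playing the role of
  the field with \<open>q\<close> elements) to a finite field \<open>'a\<close> (the field with \<open>q ^ m\<close> elements); the
  cardinalities are fixed in the statement. All linear algebra over the small field uses the
  generic module and vector space notions applied to the scalar multiplications below.
\<close>

definition field_hom :: "('k::field \<Rightarrow> 'a::field) \<Rightarrow> bool" where
  "field_hom f \<longleftrightarrow> f 1 = 1 \<and> (\<forall>x y. f (x + y) = f x + f y) \<and> (\<forall>x y. f (x * y) = f x * f y)"

definition field_automorphism :: "('k::field \<Rightarrow> 'k) \<Rightarrow> bool" where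
  "field_automorphism \<sigma> \<longleftrightarrow> field_hom \<sigma> \<and> bij \<sigma>"

definition ext_scale :: "('k::field \<Rightarrow> 'a::field) \<Rightarrow> 'k \<Rightarrow> 'a \<Rightarrow> 'a" where
  "ext_scale \<iota> c x = \<iota> c * x"

definition pair_scale :: "('k::field \<Rightarrow> 'a::field) \<Rightarrow> 'k \<Rightarrow> 'a \<times> 'a \<Rightarrow> 'a \<times> 'a" where
  "pair_scale \<iota> c v = (\<iota> c * fst v, \<iota> c * snd v)"

definition matrix_scale :: "'k::field \<Rightarrow> 'k^'n^'m \<Rightarrow> 'k^'n^'m" where
  "matrix_scale c M = map_matrix (\<lambda>x. c * x) M"

lemma vector_space_ext_scale: "field_hom \<iota> \<Longrightarrow> vector_space (ext_scale \<iota>)"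
  by (unfold_locales) (auto simp: field_hom_def ext_scale_def algebra_simps)

lemma vector_space_pair_scale: "field_hom \<iota> \<Longrightarrow> vector_space (pair_scale \<iota>)"
  by (unfold_locales) (auto simp: field_hom_def pair_scale_def algebra_simps)

lemma vector_space_matrix_scale: "vector_space matrix_scale"
  by (unfold_locales) (auto simp: matrix_scale_def vec_eq_iff algebra_simps)


text \<open>
  The norm of an extension of degree \<open>m\<close> of the field with \<open>Q\<close> elements: the product of the
  conjugates \<open>x ^ (Q ^ i)\<close>. For \<open>x\<close> in a subfield \<open>'a\<close> of that extension, all conjugates
  lie in \<open>'a\<close>, so the product can be formed there.
\<close>
definition finite_field_norm :: "nat \<Rightarrow> nat \<Rightarrow> 'a::field \<Rightarrow> 'a" where
  "finite_field_norm Q m x = (\<Prod>i<m. x ^ (Q ^ i))"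

lemma finite_field_norm_degree_2: "finite_field_norm Q 2 x = x ^ (Q + 1)"
  by (simp add: finite_field_norm_def numeral_2_eq_2)


definition scattered :: "('k::field \<Rightarrow> 'a::field) \<Rightarrow> ('a \<times> 'a) set \<Rightarrow> bool" where
  "scattered \<iota> U \<longleftrightarrow> module.subspace (pair_scale \<iota>) U \<and>
     (\<forall>v. v \<noteq> (0, 0) \<longrightarrow>
        vector_space.dim (pair_scale \<iota>) (module.span (pair_scale (\<lambda>c. c)) {v} \<inter> U) \<le> 1)"

definition U_space :: "nat \<Rightarrow> nat \<Rightarrow> 'a::field \<Rightarrow> nat \<Rightarrow> ('a \<times> 'a) set" where
  "U_space q n b s = {(x, b * x ^ (q ^ s) + x ^ (q ^ (s + n))) | x. True}"

definition U_code :: "nat \<Rightarrow> nat \<Rightarrow> 'a::field \<Rightarrow> nat \<Rightarrow> ('a \<Rightarrow> 'a) set" where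
  "U_code q n b s = {(\<lambda>x. a1 * (b * x ^ (q ^ s) + x ^ (q ^ (s + n))) + a0 * x) | a0 a1. True}"

definition H2_code :: "nat \<Rightarrow> nat \<Rightarrow> 'a::field \<Rightarrow> nat \<Rightarrow> ('a \<Rightarrow> 'a) set" where
  "H2_code q t \<mu> h =
     {(\<lambda>x. a0 * x + a1 * x ^ (q ^ t) + \<mu> * a0 ^ (q ^ h) * x ^ (q ^ (2 * t))) | a0 a1. True}"


definition is_basis :: "('k::field \<Rightarrow> 'a::field) \<Rightarrow> ('m::finite \<Rightarrow> 'a) \<Rightarrow> bool" where
  "is_basis \<iota> e \<longleftrightarrow> inj e \<and> \<not> module.dependent (ext_scale \<iota>) (range e) \<and>
     module.span (ext_scale \<iota>) (range e) = UNIV"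

text \<open>Column \<open>j\<close> holds the coordinates of \<open>f (e j)\<close> with respect to the basis \<open>e\<close>.\<close>
definition matrix_of ::
  "('k::field \<Rightarrow> 'a::field) \<Rightarrow> ('m::finite \<Rightarrow> 'a) \<Rightarrow> ('a \<Rightarrow> 'a) \<Rightarrow> 'k^'m^'m" where
  "matrix_of \<iota> e f =
     (\<chi> i j. module.representation (ext_scale \<iota>) (range e) (f (e j)) (e i))"

definition rank_distance :: "'k::field^'m^'m \<Rightarrow> 'k^'m^'m \<Rightarrow> nat" where
  "rank_distance A B = rank (A - B)"

definition min_distance :: "('k::field^'m^'m) set \<Rightarrow> nat" where
  "min_distance C = Min {rank_distance A B | A B. A \<in> C \<and> B \<in> C \<and> A \<noteq> B}"

definition linear_code :: "('k::field^'m^'m) set \<Rightarrow> bool" where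
  "linear_code C \<longleftrightarrow> module.subspace matrix_scale C"

definition code_dim :: "('k::field^'m^'m) set \<Rightarrow> nat" where
  "code_dim C = vector_space.dim matrix_scale C"

definition MRD_code :: "('k::{field,finite}^'m^'m) set \<Rightarrow> bool" where
  "MRD_code C \<longleftrightarrow> card C = CARD('k) ^ (CARD('m) * (CARD('m) - min_distance C + 1))"

definition codes_equivalent :: "('k::field^'m^'m) set \<Rightarrow> ('k^'m^'m) set \<Rightarrow> bool" where
  "codes_equivalent C C' \<longleftrightarrow>
     (\<exists>A B \<sigma>. invertible A \<and> invertible B \<and> field_automorphism \<sigma> \<and>
        ({A ** map_matrix \<sigma> M ** B | M. M \<in> C} = C' \<or>
         {A ** map_matrix \<sigma> (transpose M) ** B | M. M \<in> C} = C'))"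

end

(* The code C of U_{b,s} is spanned over the large field F by the identity and
   f(x) = b x^(q^s) + x^(q^(s+n)). An equivalence gives additive bijections P, Q of F with P C Q = H,
   where H = H_{2,t}(mu,h). Multiplications by scalars of F preserve C from the left, so their
   conjugates by P preserve H from the left. Comparing coefficients shows that only scalar
   multiplications do so; hence P is semilinear over F and P f P^-1 has the same shape as f, with
   nonzero coefficients. Now W = P Q lies in H and so does (P f P^-1) W; but the exponents of W are
   among 0, t, 2t, those of the composition are shifted by s and by s + n, and for n > 2 no nonzero
   W can keep both shifts within {0, t, 2t} modulo 2n. The transposed case is symmetric, with the
   adjoint of C, which F preserves from the right.

   The parameters follow by counting: scatteredness says that every nonzero codeword has at most
   q zeros. *)
theory Submission
  imports Defs "HOL-Number_Theory.Cong"
begin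

section \<open>Linearized polynomials over a finite field\<close>

text \<open>The library version requires the class \<open>finite_field\<close>, of which the sort
  \<open>{field, finite}\<close> is not a subclass.\<close>
lemma finite_field_power_card:
  fixes x :: "'a::{field,finite}"
  shows "x ^ CARD('a) = x"
proof (cases "x = 0")
  case False
  have "bij_betw ((*) x) (- {0}) (- {0})"
    using False by (intro bij_betw_byWitness[where f' = "\<lambda>y. y / x"]) auto
  then have "(\<Prod>y\<in>- {0}. x * y) = \<Prod>(- {0})"
    by (rule prod.reindex_bij_betw)
  then have "x ^ card (- {0::'a}) = 1"
    by (simp add: prod.distrib)
  moreover have "CARD('a) = Suc (card (- {0::'a}))"
    by (simp add: Compl_eq_Diff_UNIV card_Suc_Diff1)
  ultimately show ?thesis
    by simp
qed (simp add: power_0_left)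

text \<open>The \<open>itself\<close> parameter ties the locale to the type \<open>'a\<close>, which
  the numbers \<open>q\<close> and \<open>m\<close> do not mention.\<close>

locale frobenius =
  fixes q m :: nat and F :: "'a::{field,finite} itself"
  assumes primepow_q: "primepow q" and card_field: "CARD('a) = q ^ m"
begin

lemma q_gt_1: "q > 1"
  using primepow_gt_Suc_0[OF primepow_q] by simp

lemma q_pos [simp]: "q > 0" "q \<noteq> 0"
  using q_gt_1 by simp_all

lemma m_pos: "m > 0"
proof (rule ccontr)
  assume "\<not> m > 0"
  then have "CARD('a) = 1"
    using card_field by simp
  then show False
    using card_1_singletonE[of "UNIV :: 'a set"] zero_neq_one[where 'a = 'a]
    by (metis UNIV_I singletonD)
qed

lemma frob_add: "(x + y :: 'a) ^ (q ^ i) = x ^ (q ^ i) + y ^ (q ^ i)"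
proof -
  obtain r k where r: "prime r" "q = r ^ k"
    using primepow_q by (auto simp: primepow_def)
  have "CHAR('a) > 0"
    by (rule finite_imp_CHAR_pos) simp
  then have pr: "prime CHAR('a)"
    by (rule prime_CHAR_semidom)
  \<comment> \<open>Translation by 1 permutes the field, so it leaves the sum of all elements
    unchanged. Hence \<open>of_nat CARD('a)\<close> vanishes, and the characteristic can only be the
    prime \<open>r\<close> under \<open>q\<close>.\<close>
  have "(\<Sum>x\<in>UNIV. x + 1) = \<Sum>(UNIV :: 'a set)"
    by (rule sum.reindex_bij_betw) (simp add: bij_plus_right)
  then have "of_nat CARD('a) = (0 :: 'a)"
    by (simp add: sum.distrib)
  then have "CHAR('a) dvd CARD('a)"
    by (simp only: of_nat_eq_0_iff_char_dvd)
  then have "CHAR('a) dvd r ^ (k * m)"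
    by (simp add: card_field r power_mult)
  then have "CHAR('a) = r"
    using pr r(1) prime_dvd_power primes_dvd_imp_eq by blast
  then show ?thesis
    using freshmans_dream'[OF pr, of "q ^ i" "k * i" x y] r(2) by (simp add: power_mult)
qed

lemma frob_frob: "((x :: 'a) ^ (q ^ i)) ^ (q ^ j) = x ^ (q ^ (i + j))"
  by (simp add: power_add power_mult)

lemma frob_period: "(x :: 'a) ^ (q ^ (m * k)) = x"
proof (induction k)
  case (Suc k)
  have "x ^ (q ^ m) = x"
    using finite_field_power_card[of x] by (simp add: card_field)
  then show ?case
    using Suc frob_frob[of x m "m * k"] by simp
qed simp

lemma frob_mod: "(x :: 'a) ^ (q ^ (i mod m)) = x ^ (q ^ i)"
  by (metis frob_frob frob_period mult_div_mod_eq)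

lemma frob_cong: "[i = j] (mod m) \<Longrightarrow> (x :: 'a) ^ (q ^ i) = x ^ (q ^ j)"
  by (metis cong_def frob_mod)

text \<open>Once exponents are reduced modulo \<open>m\<close>, every term has degree below
  \<open>q ^ m\<close>, the size of the field. A sum vanishing everywhere is therefore the zero
  polynomial, and its coefficient of degree \<open>q ^ (p mod m)\<close> is \<open>c\<close>. The
  exponents in \<open>xs\<close> may coincide among themselves.\<close>

lemma isolated_coefficient:
  fixes c :: 'a and xs :: "('a \<times> nat) list"
  assumes zero: "\<And>x. c * x ^ (q ^ p) + (\<Sum>(d, r)\<leftarrow>xs. d * x ^ (q ^ r)) = 0"
    and isolated: "\<forall>(d, r)\<in>set xs. \<not> [r = p] (mod m)"
  shows "c = 0"
proof -
  define f :: "'a poly" where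
    "f = monom c (q ^ (p mod m)) + (\<Sum>(d, r)\<leftarrow>xs. monom d (q ^ (r mod m)))"
  have deg: "degree (monom d (q ^ (r mod m))) < q ^ m" for d :: 'a and r
  proof -
    have "q ^ (r mod m) < q ^ m"
      using q_gt_1 m_pos by simp
    then show ?thesis
      using degree_monom_le le_less_trans by blast
  qed
  have "degree (\<Sum>(d, r)\<leftarrow>ys. monom d (q ^ (r mod m))) < q ^ m" for ys :: "('a \<times> nat) list"
    by (induction ys) (auto intro!: degree_add_less deg)
  then have "degree f < CARD('a)"
    unfolding f_def card_field by (intro degree_add_less deg)
  moreover have "poly (\<Sum>(d, r)\<leftarrow>ys. monom d (q ^ (r mod m))) x = (\<Sum>(d, r)\<leftarrow>ys. d * x ^ (q ^ r))"
    for x and ys :: "('a \<times> nat) list"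
    by (induction ys) (auto simp: poly_monom frob_mod)
  then have "poly f x = poly 0 x" for x
    using zero by (simp add: f_def poly_monom frob_mod)
  ultimately have "f = 0"
    by (intro poly_eqI_degree[where A = UNIV]) auto
  moreover have "coeff (\<Sum>(d, r)\<leftarrow>ys. monom d (q ^ (r mod m))) (q ^ (p mod m)) = 0"
    if "\<forall>(d, r)\<in>set ys. \<not> [r = p] (mod m)" for ys :: "('a \<times> nat) list"
    using that q_gt_1 by (induction ys) (auto simp: cong_def)
  then have "coeff f (q ^ (p mod m)) = c"
    using isolated by (simp add: f_def)
  ultimately show ?thesis
    by simp
qed

lemma cong_steps_iff:
  assumes "coprime t m" "i < m" "j < m"
  shows "[i * t = j * t] (mod m) \<longleftrightarrow> i = j"
  using assms by (simp add: cong_mult_rcancel_nat cong_less_modulus_unique_nat coprime_commute)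
    (metis cong_less_modulus_unique_nat cong_refl)

text \<open>This codeword and the binomial of the next lemma are the two on which the idealiser
  arguments test \<open>g\<close>.\<close>

lemma frob_in_H2: "(\<lambda>x::'a. x ^ (q ^ t)) \<in> H2_code q t \<mu> h"
  unfolding H2_code_def by (rule CollectI, rule exI[of _ 0], rule exI[of _ 1]) (simp add: power_0_left)

lemma binomial_in_H2: "(\<lambda>x::'a. x + \<mu> * x ^ (q ^ (2 * t))) \<in> H2_code q t \<mu> h"
  unfolding H2_code_def by (rule CollectI, rule exI[of _ 1], rule exI[of _ 0]) simp

text \<open>In the natural numbers \<open>(m - 1) * t\<close> plays the part of \<open>- t\<close>
  modulo \<open>m\<close>, so it is the exponent of the inverse of
  \<open>x ^ (q ^ t)\<close>.\<close>

lemma pred_steps: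
  "(m - 1) * t + t = m * t" "t + (m - 1) * t = m * t" "(m - 1) * t + 2 * t = m * t + t"
  using m_pos by (cases m; simp)+

lemma frob_pred_steps: "(x :: 'a) ^ (q ^ ((m - 1) * t + 2 * t)) = x ^ (q ^ t)"
  unfolding pred_steps by (rule frob_cong) (simp add: cong_def)

section \<open>Idealisers and inequivalence as sets of maps\<close>

text \<open>As \<open>x ^ (q ^ t)\<close> is in the code, \<open>g\<close> has at most the terms of degrees \<open>q ^ (- t)\<close>, \<open>1\<close>, \<open>q ^ t\<close>;
  the coefficient of degree \<open>q ^ (- t)\<close> in the composition with \<open>x + \<mu> * x ^ (q ^ (2 * t))\<close> must
  vanish, and it determines the one of degree \<open>q ^ t\<close>.\<close>
lemma left_idealiser_H2:
  fixes g :: "'a \<Rightarrow> 'a"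
  assumes t: "coprime t m" and m: "m > 4"
    and g: "\<And>k. k \<in> H2_code q t \<mu> h \<Longrightarrow> g \<circ> k \<in> H2_code q t \<mu> h"
  shows "\<exists>c. \<forall>x. g x = c * x"
proof -
  have last: "\<not> [i * t = (m - 1) * t] (mod m)" if "i \<le> 3" for i
    using that m by (simp add: cong_steps_iff[OF t])
  let ?E = "\<lambda>x::'a. x + \<mu> * x ^ (q ^ (2 * t))"
  obtain a0 a1 where a: "g (x ^ (q ^ t)) =
      a0 * x + a1 * x ^ (q ^ t) + \<mu> * a0 ^ (q ^ h) * x ^ (q ^ (2 * t))" for x
    using g[OF frob_in_H2] by (auto simp: H2_code_def fun_eq_iff)
  obtain b0 b1 where b: "g (?E x) =
      b0 * x + b1 * x ^ (q ^ t) + \<mu> * b0 ^ (q ^ h) * x ^ (q ^ (2 * t))" for x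
    using g[OF binomial_in_H2] by (auto simp: H2_code_def fun_eq_iff)
  define a2 where "a2 = \<mu> * a0 ^ (q ^ h)"
  define b2 where "b2 = \<mu> * b0 ^ (q ^ h)"
  have g_eq: "g y = a0 * y ^ (q ^ ((m - 1) * t)) + a1 * y + a2 * y ^ (q ^ t)" for y
    using a[of "y ^ (q ^ ((m - 1) * t))"]
    by (simp add: frob_frob pred_steps(1) frob_pred_steps frob_period a2_def del: One_nat_def)
  \<comment> \<open>The difference of the two expressions for \<open>g (?E x)\<close>, sorted by
    exponent. Only \<open>a0\<close> stands at step \<open>m - 1\<close>, which \<open>m > 4\<close>
    keeps apart from the steps 0 to 3.\<close>
  have "a0 * x ^ (q ^ ((m - 1) * t)) + (\<Sum>(d, r)\<leftarrow>[(a1 - b0, 0 * t), (a2 - b1 + a0 * \<mu> ^ (q ^ ((m - 1) * t)), 1 * t),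
      (a1 * \<mu> - b2, 2 * t), (a2 * \<mu> ^ (q ^ t), 3 * t)]. d * x ^ (q ^ r)) = 0" for x
    using b[of x] frob_pred_steps[of x t] unfolding g_eq
    by (simp add: frob_add power_mult_distrib frob_frob b2_def algebra_simps)
  then have "a0 = 0"
    by (rule isolated_coefficient) (use last[of 0] last[of 1] last[of 2] last[of 3] in simp)
  then have "a2 = 0"
    by (simp add: a2_def power_0_left)
  then have "g y = a1 * y" for y
    using g_eq \<open>a0 = 0\<close> by simp
  then show ?thesis
    by blast
qed

text \<open>The mirror image of the left case: the test codeword gives
  \<open>(g x) ^ (q ^ t)\<close>, and raising to \<open>q ^ r\<close> with \<open>r\<close> standing
  for \<open>- t\<close> recovers \<open>g\<close> with terms of degrees \<open>q ^ (- t)\<close>,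
  \<open>1\<close>, \<open>q ^ t\<close>. The binomial again kills the first, and with it the
  last.\<close>

lemma right_idealiser_H2:
  fixes g :: "'a \<Rightarrow> 'a"
  assumes t: "coprime t m" and m: "m > 4"
    and g: "\<And>k. k \<in> H2_code q t \<mu> h \<Longrightarrow> k \<circ> g \<in> H2_code q t \<mu> h"
  shows "\<exists>c. \<forall>x. g x = c * x"
proof -
  have last: "\<not> [i * t = (m - 1) * t] (mod m)" if "i \<le> 3" for i
    using that m by (simp add: cong_steps_iff[OF t])
  let ?E = "\<lambda>x::'a. x + \<mu> * x ^ (q ^ (2 * t))"
  obtain a0 a1 where a: "(g x) ^ (q ^ t) =
      a0 * x + a1 * x ^ (q ^ t) + \<mu> * a0 ^ (q ^ h) * x ^ (q ^ (2 * t))" for x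
    using g[OF frob_in_H2] by (auto simp: H2_code_def fun_eq_iff)
  obtain b0 b1 where b: "?E (g x) =
      b0 * x + b1 * x ^ (q ^ t) + \<mu> * b0 ^ (q ^ h) * x ^ (q ^ (2 * t))" for x
    using g[OF binomial_in_H2] by (auto simp: H2_code_def fun_eq_iff)
  define b2 where "b2 = \<mu> * b0 ^ (q ^ h)"
  define r where "r = (m - 1) * t"
  define c0 where "c0 = a0 ^ (q ^ r)"
  define c1 where "c1 = a1 ^ (q ^ r)"
  define c2 where "c2 = (\<mu> * a0 ^ (q ^ h)) ^ (q ^ r)"
  have r1: "(x :: 'a) ^ (q ^ (t + r)) = x" "(x :: 'a) ^ (q ^ (2 * t + r)) = x ^ (q ^ t)"
    and r2: "(x :: 'a) ^ (q ^ (r + t * 2)) = x ^ (q ^ t)" for x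
    using frob_pred_steps[of x t] frob_period[of x t] pred_steps(2)[of t]
    by (simp_all add: r_def mult.commute[of t 2] add.commute[of "2 * t"] del: One_nat_def)
  have g_eq: "g y = c0 * y ^ (q ^ r) + c1 * y + c2 * y ^ (q ^ t)" for y
  proof -
    have "g y = ((g y) ^ (q ^ t)) ^ (q ^ r)"
      by (simp add: frob_frob r1)
    then show ?thesis
      unfolding a by (simp add: frob_add power_mult_distrib frob_frob r1 c0_def c1_def c2_def)
  qed
  have "c0 * x ^ (q ^ r) + (\<Sum>(d, r)\<leftarrow>[(c1 - b0, 0 * t), (c2 - b1 + \<mu> * c0 ^ (q ^ (2 * t)), 1 * t),
      (\<mu> * c1 ^ (q ^ (2 * t)) - b2, 2 * t), (\<mu> * c2 ^ (q ^ (2 * t)), 3 * t)]. d * x ^ (q ^ r)) = 0" for x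
    using b[of x] unfolding g_eq
    by (simp add: frob_add power_mult_distrib frob_frob r2 b2_def algebra_simps)
  then have "c0 = 0"
    unfolding r_def by (rule isolated_coefficient) (use last[of 0] last[of 1] last[of 2] last[of 3] in simp)
  then have "a0 = 0"
    by (simp add: c0_def)
  then have "c2 = 0"
    by (simp add: c2_def power_0_left)
  then have "g y = c1 * y" for y
    using g_eq \<open>c0 = 0\<close> by simp
  then show ?thesis
    by blast
qed


text \<open>No two of the exponents \<open>0\<close>, \<open>1\<close>, \<open>2\<close> differ by \<open>n\<close> modulo \<open>2 * n\<close>, so at least one of \<open>k + j\<close> and
  \<open>k + n + j\<close> cannot be cancelled by the right-hand side.\<close>
lemma antipodal_coefficients:
  fixes c c' c'' d d' d'' w w' w'' :: 'a
  assumes n: "n > 2" and m: "m = 2 * n" and t: "coprime t m"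
    and j: "j \<le> 2" "j' \<le> 2" "j'' \<le> 2" "j \<noteq> j'" "j \<noteq> j''" "j' \<noteq> j''"
    and eq: "\<And>x. c * x ^ (q ^ ((k + j) * t)) + c' * x ^ (q ^ ((k + j') * t)) + c'' * x ^ (q ^ ((k + j'') * t)) +
      d * x ^ (q ^ ((k + n + j) * t)) + d' * x ^ (q ^ ((k + n + j') * t)) + d'' * x ^ (q ^ ((k + n + j'') * t)) =
      w * x + w' * x ^ (q ^ t) + w'' * x ^ (q ^ (2 * t))"
  shows "c = 0 \<or> d = 0"
proof -
  have steps: "[a * t = b * t] (mod m) \<longleftrightarrow> [a = b] (mod m)" for a b
    using t by (simp add: cong_mult_rcancel_nat coprime_commute)
  \<comment> \<open>As \<open>n > 2\<close>, offsets of at most 2 cannot bridge the gap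
    \<open>n\<close> between the two groups of exponents; within one group, distinct offsets stay
    distinct modulo \<open>2 * n\<close>.\<close>
  have close: "\<not> [k + n + a = k + b] (mod m)" "\<not> [k + b = k + n + a] (mod m)" if "a \<le> 2" "b \<le> 2" for a b
    unfolding m add.assoc cong_add_lcancel_nat
    using that n by (auto dest: cong_less_modulus_unique_nat)
  have distinct: "\<not> [k + a = k + b] (mod m)" "\<not> [k + n + a = k + n + b] (mod m)"
    if "a \<le> 2" "b \<le> 2" "a \<noteq> b" for a b
    unfolding m add.assoc cong_add_lcancel_nat
    using that n by (auto dest: cong_less_modulus_unique_nat)
  have "(\<forall>i\<in>{0, 1, 2}. \<not> [i = k + j] (mod m)) \<or> (\<forall>i\<in>{0, 1, 2}. \<not> [i = k + n + j] (mod m))"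
  proof (rule ccontr)
    assume "\<not> ?thesis"
    then obtain i i' where i: "i \<in> {0, 1, 2}" "i' \<in> {0, 1, 2}" "[i = k + j] (mod m)" "[i' = k + n + j] (mod m)"
      by blast
    have "[n + i = n + (k + j)] (mod m)"
      using i(3) by (simp only: cong_add_lcancel_nat)
    then have "[i' = n + i] (mod m)"
      using i(4) by (metis add.assoc add.commute cong_sym cong_trans)
    then show False
      using i n m by (auto dest: cong_less_modulus_unique_nat)
  qed
  then show ?thesis
  proof
    assume "\<forall>i\<in>{0, 1, 2}. \<not> [i = k + j] (mod m)"
    then have small: "\<not> [0 = k + j] (mod m)" "\<not> [1 = k + j] (mod m)" "\<not> [2 = k + j] (mod m)"
      by blast+
    have "c * x ^ (q ^ ((k + j) * t)) + (\<Sum>(d, r)\<leftarrow>[(c', (k + j') * t), (c'', (k + j'') * t),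
      (d, (k + n + j) * t), (d', (k + n + j') * t), (d'', (k + n + j'') * t), (- w, 0 * t), (- w', 1 * t), (- w'', 2 * t)].
      d * x ^ (q ^ r)) = 0" for x
      using eq[of x] by (simp add: algebra_simps)
    then have "c = 0"
      by (rule isolated_coefficient)
        (simp only: list.set ball_simps prod.case steps simp_thms close distinct j j(4-6)[symmetric] small)
    then show ?thesis ..
  next
    assume "\<forall>i\<in>{0, 1, 2}. \<not> [i = k + n + j] (mod m)"
    then have small: "\<not> [0 = k + n + j] (mod m)" "\<not> [1 = k + n + j] (mod m)" "\<not> [2 = k + n + j] (mod m)"
      by blast+
    have "d * x ^ (q ^ ((k + n + j) * t)) + (\<Sum>(d, r)\<leftarrow>[(c, (k + j) * t), (c', (k + j') * t), (c'', (k + j'') * t),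
      (d', (k + n + j') * t), (d'', (k + n + j'') * t), (- w, 0 * t), (- w', 1 * t), (- w'', 2 * t)].
      d * x ^ (q ^ r)) = 0" for x
      using eq[of x] by (simp add: algebra_simps)
    then have "d = 0"
      by (rule isolated_coefficient)
        (simp only: list.set ball_simps prod.case steps simp_thms close distinct j j(4-6)[symmetric] small)
    then show ?thesis ..
  qed
qed

text \<open>Since \<open>t\<close> is invertible modulo \<open>m\<close>, the exponent
  \<open>s\<close> is a multiple \<open>k * t\<close>. Adding \<open>n\<close> to \<open>k\<close>
  adds \<open>n * t\<close>, which is \<open>n\<close> modulo \<open>2 * n\<close> because
  \<open>t\<close> is odd.\<close>

lemma step_of_exponent:
  assumes m: "m = 2 * n" and t: "coprime t m"
  obtains k where "[k * t = s] (mod m)" "[(k + n) * t = s + n] (mod m)"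
proof -
  obtain u where "[t * u = 1] (mod m)"
    using cong_solve_coprime_nat[OF t] by auto
  then have "[t * u * s = 1 * s] (mod m)"
    by (rule cong_scalar_right)
  then have 1: "[(u * s) * t = s] (mod m)"
    by (simp add: ac_simps)
  have "odd t"
    using coprime_common_divisor_nat[OF t, of 2] m by auto
  then obtain l where "t = 2 * l + 1"
    by (rule oddE)
  then have "n * t = m * l + n"
    by (simp add: m algebra_simps)
  then have "[n * t = n] (mod m)"
    by (simp add: cong_def)
  from cong_add[OF 1 this] have "[(u * s + n) * t = s + n] (mod m)"
    by (simp add: algebra_simps)
  with 1 show ?thesis
    by (rule that)
qed

text \<open>A nonzero coefficient of \<open>W\<close> at step \<open>j\<close> produces, in either
  order of composition, nonzero coefficients at both steps \<open>k + j\<close> and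
  \<open>k + n + j\<close>, where \<open>k * t\<close> is \<open>s\<close> modulo \<open>m\<close>.
  They cannot both be present in a member of the code.\<close>

lemma composition_notin_H2:
  fixes W f :: "'a \<Rightarrow> 'a" and \<alpha> \<beta> :: 'a
  assumes n: "n > 2" and m: "m = 2 * n" and t: "coprime t m"
    and W: "W \<in> H2_code q t \<mu> h" and nz: "W z \<noteq> 0"
    and ab: "\<alpha> \<noteq> 0" "\<beta> \<noteq> 0"
    and f: "\<And>x. f x = \<alpha> * x ^ (q ^ s) + \<beta> * x ^ (q ^ (s + n))"
  shows "f \<circ> W \<notin> H2_code q t \<mu> h" and "W \<circ> f \<notin> H2_code q t \<mu> h"
proof -
  obtain a0 a1 where "W = (\<lambda>x. a0 * x + a1 * x ^ (q ^ t) + \<mu> * a0 ^ (q ^ h) * x ^ (q ^ (2 * t)))"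
    using W unfolding H2_code_def by blast
  then obtain a2 where Wx: "W x = a0 * x + a1 * x ^ (q ^ t) + a2 * x ^ (q ^ (2 * t))" for x
    by auto
  then have a: "\<not> (a0 = 0 \<and> a1 = 0 \<and> a2 = 0)"
    using nz by auto
  obtain k where k: "[k * t = s] (mod m)" "[(k + n) * t = s + n] (mod m)"
    using step_of_exponent[OF m t] .
  have ks: "(x :: 'a) ^ (q ^ (s + i * t)) = x ^ (q ^ ((k + i) * t))"
    "(x :: 'a) ^ (q ^ (s + n + i * t)) = x ^ (q ^ ((k + n + i) * t))" for x i
    using k by (auto intro!: frob_cong simp: add_mult_distrib cong_sym cong_add)
  have no: False
    if eq: "\<And>x. c0 * x ^ (q ^ ((k + 0) * t)) + c1 * x ^ (q ^ ((k + 1) * t)) + c2 * x ^ (q ^ ((k + 2) * t)) +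
      d0 * x ^ (q ^ ((k + n + 0) * t)) + d1 * x ^ (q ^ ((k + n + 1) * t)) + d2 * x ^ (q ^ ((k + n + 2) * t)) =
      w * x + w' * x ^ (q ^ t) + w'' * x ^ (q ^ (2 * t))"
      and nz: "c0 \<noteq> 0 \<and> d0 \<noteq> 0 \<or> c1 \<noteq> 0 \<and> d1 \<noteq> 0 \<or> c2 \<noteq> 0 \<and> d2 \<noteq> 0"
    for c0 c1 c2 d0 d1 d2 w w' w'' :: 'a
  proof -
    \<comment> \<open>Each of the three steps takes the distinguished place \<open>j\<close> in
      turn, the other two filling \<open>j'\<close> and \<open>j''\<close>.\<close>
    note lem = antipodal_coefficients[OF n m t, where k = k]
    have "c0 = 0 \<or> d0 = 0"
      by (rule lem[where j = 0 and j' = 1 and j'' = 2 and c = c0 and c' = c1 and c'' = c2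
        and d = d0 and d' = d1 and d'' = d2 and w = w and w' = w' and w'' = w''])
        (use eq in auto)
    moreover have "c1 = 0 \<or> d1 = 0"
      by (rule lem[where j = 1 and j' = 0 and j'' = 2 and c = c1 and c' = c0 and c'' = c2
        and d = d1 and d' = d0 and d'' = d2 and w = w and w' = w' and w'' = w''])
        (use eq in \<open>auto simp: algebra_simps\<close>)
    moreover have "c2 = 0 \<or> d2 = 0"
      by (rule lem[where j = 2 and j' = 1 and j'' = 0 and c = c2 and c' = c1 and c'' = c0
        and d = d2 and d' = d1 and d'' = d0 and w = w and w' = w' and w'' = w''])
        (use eq in \<open>auto simp: algebra_simps\<close>)
    ultimately show False
      using nz by auto
  qed
  have H2D: "\<exists>w w' w''. \<forall>x. g x = w * x + w' * x ^ (q ^ t) + w'' * x ^ (q ^ (2 * t))"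
    if "g \<in> H2_code q t \<mu> h" for g :: "'a \<Rightarrow> 'a"
    using that unfolding H2_code_def by auto
  show "f \<circ> W \<notin> H2_code q t \<mu> h"
  proof
    assume "f \<circ> W \<in> H2_code q t \<mu> h"
    then obtain w w' w'' where w: "f (W x) = w * x + w' * x ^ (q ^ t) + w'' * x ^ (q ^ (2 * t))" for x
      using H2D by fastforce
    have "f (W x) =
      \<alpha> * a0 ^ (q ^ s) * x ^ (q ^ (s + 0 * t)) + \<alpha> * a1 ^ (q ^ s) * x ^ (q ^ (s + 1 * t)) +
      \<alpha> * a2 ^ (q ^ s) * x ^ (q ^ (s + 2 * t)) +
      \<beta> * a0 ^ (q ^ (s + n)) * x ^ (q ^ (s + n + 0 * t)) + \<beta> * a1 ^ (q ^ (s + n)) * x ^ (q ^ (s + n + 1 * t)) +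
      \<beta> * a2 ^ (q ^ (s + n)) * x ^ (q ^ (s + n + 2 * t))" for x
      by (simp add: f Wx frob_add power_mult_distrib frob_frob algebra_simps)
    from no[OF this[unfolded ks w, symmetric]] show False
      using a ab by auto
  qed
  show "W \<circ> f \<notin> H2_code q t \<mu> h"
  proof
    assume "W \<circ> f \<in> H2_code q t \<mu> h"
    then obtain w w' w'' where w: "W (f x) = w * x + w' * x ^ (q ^ t) + w'' * x ^ (q ^ (2 * t))" for x
      using H2D by fastforce
    have "W (f x) =
      a0 * \<alpha> * x ^ (q ^ (s + 0 * t)) + a1 * \<alpha> ^ (q ^ t) * x ^ (q ^ (s + 1 * t)) +
      a2 * \<alpha> ^ (q ^ (2 * t)) * x ^ (q ^ (s + 2 * t)) +
      a0 * \<beta> * x ^ (q ^ (s + n + 0 * t)) + a1 * \<beta> ^ (q ^ t) * x ^ (q ^ (s + n + 1 * t)) +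
      a2 * \<beta> ^ (q ^ (2 * t)) * x ^ (q ^ (s + n + 2 * t))" for x
      by (simp add: f Wx frob_add power_mult_distrib frob_frob algebra_simps)
    from no[OF this[unfolded ks w, symmetric]] show False
      using a ab by auto
  qed
qed

section \<open>Semilinear conjugation and the two contradictions\<close>

text \<open>With \<open>p = R 1\<close> one has \<open>R x = \<tau> x * p\<close>, and
  \<open>\<tau>\<close> is multiplicative. So \<open>R\<close> carries a power of \<open>x\<close>
  to the same power of \<open>R x\<close> up to a nonzero constant; the quotients
  \<open>p / p ^ (q ^ s)\<close> and \<open>p / p ^ (q ^ r)\<close> correct for the surplus powers
  of \<open>p\<close>.\<close>

lemma conjugate_binomial:
  fixes R \<tau> f :: "'a \<Rightarrow> 'a" and \<alpha> \<beta> :: 'a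
  assumes inj: "inj R" and add: "\<And>x y. R (x + y) = R x + R y"
    and mult: "\<And>c x. R (c * x) = \<tau> c * R x"
    and f: "\<And>x. f x = \<alpha> * x ^ (q ^ s) + \<beta> * x ^ (q ^ r)"
    and ab: "\<alpha> \<noteq> 0" "\<beta> \<noteq> 0"
  obtains \<alpha>' \<beta>' where "\<alpha>' \<noteq> 0" "\<beta>' \<noteq> 0"
    "\<And>x. R (f x) = \<alpha>' * R x ^ (q ^ s) + \<beta>' * R x ^ (q ^ r)"
proof -
  have "R 0 = 0"
    using add[of 0 0] by (metis add.right_neutral add_left_cancel)
  then have R0: "R x = 0 \<longleftrightarrow> x = 0" for x
    using inj by (metis injD)
  define p where "p = R 1"
  have p: "p \<noteq> 0"
    by (simp add: p_def R0)
  have R: "R x = \<tau> x * p" for x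
    using mult[of x 1] by (simp add: p_def)
  have \<tau>0: "\<tau> x \<noteq> 0" if "x \<noteq> 0" for x
    using R0[of x] that by (auto simp: R)
  have "\<tau> (x * y) * p = \<tau> x * \<tau> y * p" for x y
    using mult[of x y] by (simp add: R)
  then have \<tau>_mult: "\<tau> (x * y) = \<tau> x * \<tau> y" for x y
    using p by simp
  have \<tau>_power: "\<tau> (x ^ i) = \<tau> x ^ i" for x i
  proof (induction i)
    case 0
    show ?case
      using R[of 1] p by (simp add: p_def)
  qed (simp add: \<tau>_mult)
  have "R (f x) = (\<tau> \<alpha> * p / p ^ (q ^ s)) * R x ^ (q ^ s) + (\<tau> \<beta> * p / p ^ (q ^ r)) * R x ^ (q ^ r)" for x
    using p unfolding f add mult by (simp add: R \<tau>_mult \<tau>_power power_mult_distrib)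
  then show ?thesis
    using that[of "\<tau> \<alpha> * p / p ^ (q ^ s)" "\<tau> \<beta> * p / p ^ (q ^ r)"] p ab \<tau>0 by simp
qed

lemma left_linear_code_not_H2:
  fixes P Q f :: "'a \<Rightarrow> 'a" and \<alpha> \<beta> :: 'a
  assumes n: "n > 2" and m: "m = 2 * n" and t: "coprime t m"
    and f: "\<And>x. f x = \<alpha> * x ^ (q ^ s) + \<beta> * x ^ (q ^ (s + n))" and ab: "\<alpha> \<noteq> 0" "\<beta> \<noteq> 0"
    and C: "C = {\<lambda>x. a1 * f x + a0 * x | a0 a1. True}"
    and bij: "bij P" "bij Q" and add: "\<And>x y. P (x + y) = P x + P y"
  shows "(\<lambda>k. P \<circ> k \<circ> Q) ` C \<noteq> H2_code q t \<mu> h"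
proof
  assume eq: "(\<lambda>k. P \<circ> k \<circ> Q) ` C = H2_code q t \<mu> h"
  \<comment> \<open>Multiplication by \<open>c\<close> maps \<open>C\<close> into itself from the
    left, so its conjugate by \<open>P\<close> maps the image code into itself from the
    left.\<close>
  have "\<exists>d. \<forall>x. (P \<circ> (\<lambda>x. c * x) \<circ> inv P) x = d * x" for c
  proof (rule left_idealiser_H2[OF t])
    show "m > 4"
      using n m by simp
    fix k assume "k \<in> H2_code q t \<mu> h"
    then obtain a0 a1 where "k = P \<circ> (\<lambda>x. a1 * f x + a0 * x) \<circ> Q"
      unfolding eq[symmetric] C by auto
    then have "P \<circ> (\<lambda>x. c * x) \<circ> inv P \<circ> k = P \<circ> (\<lambda>x. (c * a1) * f x + (c * a0) * x) \<circ> Q"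
      using bij(1) by (auto simp: fun_eq_iff bij_is_inj algebra_simps)
    moreover have "(\<lambda>x. (c * a1) * f x + (c * a0) * x) \<in> C"
      unfolding C by blast
    ultimately show "P \<circ> (\<lambda>x. c * x) \<circ> inv P \<circ> k \<in> H2_code q t \<mu> h"
      unfolding eq[symmetric] by blast
  qed
  then obtain \<tau> where \<tau>: "\<And>c x. P (c * inv P x) = \<tau> c * x"
    unfolding comp_apply by metis
  have mult: "P (c * x) = \<tau> c * P x" for c x
    using \<tau>[of c "P x"] bij(1) by (simp add: bij_is_inj)
  obtain \<alpha>' \<beta>' where ab': "\<alpha>' \<noteq> 0" "\<beta>' \<noteq> 0"
    "\<And>x. P (f x) = \<alpha>' * P x ^ (q ^ s) + \<beta>' * P x ^ (q ^ (s + n))"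
    using conjugate_binomial[OF bij_is_inj[OF bij(1)] add mult f ab] by blast
  \<comment> \<open>The identity and \<open>f\<close> become \<open>W = P \<circ> Q\<close> and the
    conjugated binomial composed with \<open>W\<close>.\<close>
  have "(\<lambda>x. 0 * f x + 1 * x) \<in> C" "(\<lambda>x. 1 * f x + 0 * x) \<in> C"
    unfolding C by blast+
  then have "P \<circ> (\<lambda>x. x) \<circ> Q \<in> H2_code q t \<mu> h" "P \<circ> f \<circ> Q \<in> H2_code q t \<mu> h"
    unfolding eq[symmetric] by auto
  then have W: "P \<circ> Q \<in> H2_code q t \<mu> h"
    and fW: "(\<lambda>y. \<alpha>' * y ^ (q ^ s) + \<beta>' * y ^ (q ^ (s + n))) \<circ> (P \<circ> Q) \<in> H2_code q t \<mu> h"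
    by (simp_all add: comp_def ab'(3))
  obtain z where "(P \<circ> Q) z = 1"
    using bij by (metis bij_comp bij_pointE)
  then have "(P \<circ> Q) z \<noteq> 0"
    by simp
  from composition_notin_H2(1)[OF n m t W this ab'(1,2) refl] fW show False
    by blast
qed

text \<open>The scalar \<open>a1\<close> sits inside \<open>f\<close> because taking adjoints turns
  a left factor into a right one. The field now acts from the right, so it is \<open>inv Q\<close>
  that becomes semilinear, and the conjugated binomial is applied before
  \<open>P \<circ> Q\<close>.\<close>

lemma right_linear_code_not_H2:
  fixes P Q f :: "'a \<Rightarrow> 'a" and \<alpha> \<beta> :: 'a
  assumes n: "n > 2" and m: "m = 2 * n" and t: "coprime t m"
    and f: "\<And>x. f x = \<alpha> * x ^ (q ^ s) + \<beta> * x ^ (q ^ (s + n))" and ab: "\<alpha> \<noteq> 0" "\<beta> \<noteq> 0"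
    and C: "C = {\<lambda>x. f (a1 * x) + a0 * x | a0 a1. True}"
    and bij: "bij P" "bij Q" and add: "\<And>x y. Q (x + y) = Q x + Q y"
  shows "(\<lambda>k. P \<circ> k \<circ> Q) ` C \<noteq> H2_code q t \<mu> h"
proof
  assume eq: "(\<lambda>k. P \<circ> k \<circ> Q) ` C = H2_code q t \<mu> h"
  have Q: "inv Q (Q x) = x" "Q (inv Q x) = x" for x
    using bij(2) by (simp_all add: bij_is_inj bij_is_surj surj_f_inv_f)
  have "\<exists>d. \<forall>x. (inv Q \<circ> (\<lambda>x. c * x) \<circ> Q) x = d * x" for c
  proof (rule right_idealiser_H2[OF t])
    show "m > 4"
      using n m by simp
    fix k assume "k \<in> H2_code q t \<mu> h"
    then obtain a0 a1 where "k = P \<circ> (\<lambda>x. f (a1 * x) + a0 * x) \<circ> Q"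
      unfolding eq[symmetric] C by auto
    then have "k \<circ> (inv Q \<circ> (\<lambda>x. c * x) \<circ> Q) = P \<circ> (\<lambda>x. f ((a1 * c) * x) + (a0 * c) * x) \<circ> Q"
      by (auto simp: fun_eq_iff Q algebra_simps)
    moreover have "(\<lambda>x. f ((a1 * c) * x) + (a0 * c) * x) \<in> C"
      unfolding C by blast
    ultimately show "k \<circ> (inv Q \<circ> (\<lambda>x. c * x) \<circ> Q) \<in> H2_code q t \<mu> h"
      unfolding eq[symmetric] by blast
  qed
  then obtain \<tau> where \<tau>: "\<And>c x. inv Q (c * Q x) = \<tau> c * x"
    unfolding comp_apply by metis
  have mult: "inv Q (c * x) = \<tau> c * inv Q x" for c x
    using \<tau>[of c "inv Q x"] by (simp add: Q)
  have add': "inv Q (x + y) = inv Q x + inv Q y" for x y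
    using add[of "inv Q x" "inv Q y"] Q by metis
  obtain \<alpha>' \<beta>' where ab': "\<alpha>' \<noteq> 0" "\<beta>' \<noteq> 0"
    "\<And>x. inv Q (f x) = \<alpha>' * inv Q x ^ (q ^ s) + \<beta>' * inv Q x ^ (q ^ (s + n))"
    using conjugate_binomial[OF bij_is_inj[OF bij_imp_bij_inv[OF bij(2)]] add' mult f ab] by blast
  have fQ: "f (Q x) = Q (\<alpha>' * x ^ (q ^ s) + \<beta>' * x ^ (q ^ (s + n)))" for x
    using ab'(3)[of "Q x"] Q by metis
  have "(\<lambda>x. f (0 * x) + 1 * x) \<in> C" "(\<lambda>x. f (1 * x) + 0 * x) \<in> C"
    unfolding C by blast+
  moreover have "(\<lambda>x. f (0 * x) + 1 * x) = (\<lambda>x. x)" "(\<lambda>x. f (1 * x) + 0 * x) = f"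
    by (simp_all add: f fun_eq_iff power_0_left)
  ultimately have "P \<circ> (\<lambda>x. x) \<circ> Q \<in> H2_code q t \<mu> h" "P \<circ> f \<circ> Q \<in> H2_code q t \<mu> h"
    unfolding eq[symmetric] by auto
  then have W: "P \<circ> Q \<in> H2_code q t \<mu> h"
    and fW: "(P \<circ> Q) \<circ> (\<lambda>y. \<alpha>' * y ^ (q ^ s) + \<beta>' * y ^ (q ^ (s + n))) \<in> H2_code q t \<mu> h"
    by (simp_all add: comp_def fQ)
  obtain z where "(P \<circ> Q) z = 1"
    using bij by (metis bij_comp bij_pointE)
  then have "(P \<circ> Q) z \<noteq> 0"
    by simp
  from composition_notin_H2(2)[OF n m t W this ab'(1,2) refl] fW show False
    by blast
qed

end

section \<open>Matrices and equivalence of codes\<close>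

definition map_vec :: "('k \<Rightarrow> 'k) \<Rightarrow> 'k^'m \<Rightarrow> 'k^'m" where
  "map_vec \<sigma> v = (\<chi> i. \<sigma> (v $ i))"

lemma field_hom_0: "field_hom \<sigma> \<Longrightarrow> \<sigma> 0 = 0"
  unfolding field_hom_def by (metis add.right_neutral add_left_cancel)

lemma field_hom_sum: "field_hom \<sigma> \<Longrightarrow> \<sigma> (sum f A) = (\<Sum>i\<in>A. \<sigma> (f i))"
  by (induction A rule: infinite_finite_induct) (auto simp: field_hom_0, simp add: field_hom_def)

lemma map_vec_mult: "field_hom \<sigma> \<Longrightarrow> map_vec \<sigma> (M *v v) = map_matrix \<sigma> M *v map_vec \<sigma> v"
  by (simp add: map_vec_def matrix_vector_mult_def vec_eq_iff field_hom_sum)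
    (simp add: field_hom_def)

lemma bij_map_vec: "bij \<sigma> \<Longrightarrow> bij (map_vec \<sigma>)"
  by (intro bij_betw_byWitness[where f' = "map_vec (inv \<sigma>)"])
    (auto simp: map_vec_def vec_eq_iff bij_is_inj bij_is_surj surj_f_inv_f)

lemma bij_matrix_mult: "invertible A \<Longrightarrow> bij ((*v) (A :: 'k::field^'m^'m))"
  unfolding invertible_def
  by (elim exE) (rule_tac f' = "(*v) A'" in bij_betw_byWitness, auto simp: matrix_vector_mul_assoc)

lemma range_pair: "{g (a, b) | a b. True} = range g"
  by (auto simp: image_iff)

section \<open>Coordinates over the base field\<close>

locale field_extension = frobenius q m F for q m and F :: "'a::{field,finite} itself" +
  fixes \<iota> :: "'k::{field,finite} \<Rightarrow> 'a" and e :: "'m::finite \<Rightarrow> 'a"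
  assumes card_base: "CARD('k) = q" and hom: "field_hom \<iota>" and basis: "is_basis \<iota> e"
begin

sublocale ext: vector_space "ext_scale \<iota>"
  by (rule vector_space_ext_scale[OF hom])

definition of_coords :: "'k^'m \<Rightarrow> 'a" where
  "of_coords v = (\<Sum>i\<in>UNIV. \<iota> (v $ i) * e i)"

definition coords :: "'a \<Rightarrow> 'k^'m" where
  "coords x = (\<chi> i. ext.representation (range e) x (e i))"

definition k_linear :: "('a \<Rightarrow> 'a) \<Rightarrow> bool" where
  "k_linear f \<longleftrightarrow> (\<forall>x y. f (x + y) = f x + f y) \<and> (\<forall>c x. f (\<iota> c * x) = \<iota> c * f x)"

lemma \<iota>_simps: "\<iota> 0 = 0" "\<iota> 1 = 1" "\<iota> (c + d) = \<iota> c + \<iota> d" "\<iota> (c * d) = \<iota> c * \<iota> d"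
  using hom field_hom_0[OF hom] by (auto simp: field_hom_def)

lemma \<iota>_power: "\<iota> (c ^ i) = \<iota> c ^ i"
  by (induction i) (auto simp: \<iota>_simps)

text \<open>The \<open>q\<close> elements of the base field are fixed by the \<open>q\<close>-th
  power; this makes every \<open>x ^ (q ^ i)\<close> linear over it.\<close>

lemma \<iota>_frob: "\<iota> c ^ (q ^ i) = \<iota> c"
proof (induction i)
  case (Suc i)
  have "\<iota> c ^ q = \<iota> c"
    using finite_field_power_card[of c] by (simp add: card_base flip: \<iota>_power)
  then show ?case
    using Suc by (simp add: power_mult)
qed simp

lemma inj_e: "inj e" and indep: "ext.independent (range e)" and span: "ext.span (range e) = UNIV"
  using basis by (auto simp: is_basis_def)

lemma of_coords_coords [simp]: "of_coords (coords x) = x"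
proof -
  have "(\<Sum>b\<in>range e. ext_scale \<iota> (ext.representation (range e) x b) b) = x"
    by (rule ext.sum_representation_eq[OF indep]) (auto simp: span)
  then show ?thesis
    by (simp add: of_coords_def coords_def ext_scale_def sum.reindex[OF inj_e])
qed

lemma bij_coords: "bij coords"
proof -
  have "inj coords"
    by (metis injI of_coords_coords)
  moreover have "surj coords"
  proof (rule surjI[where f = of_coords])
    fix v :: "'k^'m"
    \<comment> \<open>The expected representation of \<open>of_coords v\<close>, extended by 0
      because representations vanish off the basis.\<close>
    define r where "r = (\<lambda>b. if b \<in> range e then v $ (inv e b) else 0)"
    have "ext.representation (range e) (of_coords v) = r"
    proof (rule ext.representation_eqI[OF indep])
      have "(\<Sum>b | r b \<noteq> 0. ext_scale \<iota> (r b) b) = (\<Sum>b\<in>range e. ext_scale \<iota> (r b) b)"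
        by (rule sum.mono_neutral_left) (auto simp: r_def ext_scale_def \<iota>_simps split: if_splits)
      also have "\<dots> = of_coords v"
        by (simp add: sum.reindex[OF inj_e] of_coords_def ext_scale_def r_def inj_e)
      finally show "(\<Sum>b | r b \<noteq> 0. ext_scale \<iota> (r b) b) = of_coords v" .
    qed (auto simp: span r_def split: if_splits)
    then show "coords (of_coords v) = v"
      by (simp add: coords_def r_def vec_eq_iff inj_e)
  qed
  ultimately show ?thesis
    by (simp add: bij_def)
qed

lemma coords_of_coords [simp]: "coords (of_coords v) = v"
  using bij_coords by (metis bij_pointE of_coords_coords)

lemma of_coords_add: "of_coords (v + w) = of_coords v + of_coords w"
  by (simp add: of_coords_def \<iota>_simps distrib_right sum.distrib)

lemma of_coords_scale: "of_coords (c *s v) = \<iota> c * of_coords v"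
  by (simp add: of_coords_def \<iota>_simps sum_distrib_left mult.assoc)

lemma coords_add: "coords (x + y) = coords x + coords y"
  by (metis coords_of_coords of_coords_add of_coords_coords)

lemma coords_0 [simp]: "coords 0 = 0"
  using coords_add[of 0 0] by (metis add.right_neutral add_left_cancel)

lemma coords_scale: "coords (\<iota> c * x) = c *s coords x"
  by (metis coords_of_coords of_coords_scale of_coords_coords)

lemma bij_of_coords: "bij of_coords"
  by (rule bij_betw_byWitness[where f' = coords]) auto

lemma coords_basis: "coords (e i) $ i = 1"
  using ext.representation_basis[OF indep, of "e i"] by (simp add: coords_def)

lemma functional_of_coords:
  fixes \<phi> :: "'a \<Rightarrow> 'k"
  assumes "\<And>x y. \<phi> (x + y) = \<phi> x + \<phi> y" "\<And>c x. \<phi> (\<iota> c * x) = c * \<phi> x"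
  shows "\<phi> (of_coords v) = (\<Sum>i\<in>UNIV. v $ i * \<phi> (e i))"
proof -
  have "\<phi> 0 = 0"
    using assms(2)[of 0 0] by (simp add: \<iota>_simps)
  then have "\<phi> (\<Sum>i\<in>S. \<iota> (v $ i) * e i) = (\<Sum>i\<in>S. v $ i * \<phi> (e i))" for S
    by (induction S rule: infinite_finite_induct) (auto simp: assms)
  then show ?thesis
    by (simp add: of_coords_def)
qed

lemma matrix_of_nth: "matrix_of \<iota> e f $ i $ j = coords (f (e j)) $ i"
  by (simp add: matrix_of_def coords_def)

lemma matrix_of_mult:
  assumes "k_linear f"
  shows "matrix_of \<iota> e f *v coords x = coords (f x)"
proof -
  have "coords (f x) $ i = (\<Sum>j\<in>UNIV. coords x $ j * coords (f (e j)) $ i)" for i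
    using functional_of_coords[of "\<lambda>x. coords (f x) $ i" "coords x"] assms
    by (simp add: k_linear_def coords_add coords_scale)
  then show ?thesis
    by (simp add: vec_eq_iff matrix_vector_mult_def matrix_of_nth mult.commute)
qed

section \<open>Transposition as an adjoint\<close>

text \<open>Any nonzero functional can replace the trace: the adjoint of \<open>x ^ (q ^ s)\<close> is then still
  \<open>c * x ^ (q ^ r)\<close> with \<open>c \<noteq> 0\<close> and \<open>s + r\<close> divisible by \<open>m\<close>.\<close>
definition lam :: "'a \<Rightarrow> 'k" where
  "lam x = coords x $ undefined"

lemma lam_add: "lam (x + y) = lam x + lam y" and lam_scale: "lam (\<iota> c * x) = c * lam x"
  by (simp_all add: lam_def coords_add coords_scale)

text \<open>For \<open>y \<noteq> 0\<close> the products \<open>x * y\<close> run through the whole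
  field, including the basis element on which \<open>lam\<close> is 1.\<close>

lemma lam_nondegenerate:
  assumes "\<And>x. lam (x * y) = 0"
  shows "y = 0"
proof (rule ccontr)
  assume "y \<noteq> 0"
  then have "lam (e undefined) = 0"
    using assms[of "e undefined / y"] by simp
  then show False
    by (simp add: lam_def coords_basis)
qed

text \<open>The coordinates of \<open>y\<close> in the basis dual to \<open>e\<close> under the
  pairing \<open>lam (x * y)\<close>.\<close>

definition dual :: "'a \<Rightarrow> 'k^'m" where
  "dual y = (\<chi> i. lam (e i * y))"

lemma dual_add: "dual (x + y) = dual x + dual y"
  by (simp add: dual_def vec_eq_iff distrib_left lam_add)

lemma dual_0 [simp]: "dual 0 = 0"
  using dual_add[of 0 0] by (metis add.right_neutral add_left_cancel)

lemma functional_eq_lam: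
  assumes "\<And>x y. \<phi> (x + y) = \<phi> x + \<phi> y" "\<And>c x. \<phi> (\<iota> c * x) = c * \<phi> x"
    and "dual y = (\<chi> i. \<phi> (e i))"
  shows "\<phi> x = lam (x * y)"
proof -
  have "\<phi> (of_coords (coords x)) = lam (of_coords (coords x) * y)"
    using assms(3) functional_of_coords[OF assms(1,2), of "coords x"]
      functional_of_coords[of "\<lambda>x. lam (x * y)" "coords x"]
    by (simp add: dual_def vec_eq_iff distrib_right mult.assoc lam_add lam_scale del: of_coords_coords)
  then show ?thesis
    by simp
qed

text \<open>Injectivity is nondegeneracy of the pairing; surjectivity follows as both sides have
  equal finite cardinality.\<close>

lemma bij_dual: "bij dual"
proof -
  have "inj dual"
  proof (rule injI)
    fix x y assume "dual x = dual y"
    then have "dual (x - y) = dual 0"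
      using dual_add[of "x - y" y] by simp
    then have "0 = lam (z * (x - y))" for z
      by (intro functional_eq_lam) (auto simp: vec_eq_iff)
    then have "x - y = 0"
      using lam_nondegenerate[of "x - y"] by simp
    then show "x = y"
      by simp
  qed
  moreover have "CARD('a) = CARD('k^'m)"
    by (rule bij_betw_same_card[OF bij_coords])
  ultimately show ?thesis
    by (metis card_image card_subset_eq finite subset_UNIV bij_def)
qed

lemma functional_representable:
  assumes "\<And>x y. \<phi> (x + y) = \<phi> x + \<phi> y" "\<And>c x. \<phi> (\<iota> c * x) = c * \<phi> x"
  obtains y where "\<And>x. \<phi> x = lam (x * y)"
proof -
  obtain y where "dual y = (\<chi> i. \<phi> (e i))"
    using bij_dual by (metis bij_pointE)
  from functional_eq_lam[OF assms this] show ?thesis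
    by (rule that)
qed

text \<open>The factor \<open>c\<close> represents the functional \<open>lam (x ^ (q ^ s))\<close>.
  Replacing \<open>x\<close> by \<open>x * y ^ (q ^ r)\<close> gives the adjoint, since raising to
  \<open>q ^ r\<close> and then to \<open>q ^ s\<close> is the identity.\<close>

lemma frob_adjoint:
  assumes "[s + r = 0] (mod m)"
  obtains c where "c \<noteq> 0" "\<And>x y. lam (x ^ (q ^ s) * y) = lam (x * (c * y ^ (q ^ r)))"
proof -
  obtain c where c: "\<And>x. lam (x ^ (q ^ s)) = lam (x * c)"
    by (rule functional_representable[of "\<lambda>x. lam (x ^ (q ^ s))"])
      (auto simp: frob_add lam_add power_mult_distrib \<iota>_frob lam_scale)
  have inv1: "(y ^ (q ^ r)) ^ (q ^ s) = y" for y :: 'a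
    using frob_cong[OF assms, of y] by (simp add: frob_frob add.commute)
  have "c \<noteq> 0"
  proof
    assume "c = 0"
    \<comment> \<open>Every element is a \<open>q ^ s\<close>-th power, so \<open>c = 0\<close>
      would make \<open>lam\<close> vanish identically.\<close>
    then have "lam ((x ^ (q ^ r)) ^ (q ^ s) * 1) = 0" for x
      using c[of "x ^ (q ^ r)"] by (simp add: lam_def)
    then have "lam (x * 1) = 0" for x
      by (simp add: inv1)
    then show False
      using lam_nondegenerate[of 1] by simp
  qed
  moreover have "lam (x ^ (q ^ s) * y) = lam (x * (c * y ^ (q ^ r)))" for x y
    using c[of "x * y ^ (q ^ r)"] by (simp add: power_mult_distrib inv1 ac_simps)
  ultimately show ?thesis
    by (rule that)
qed

text \<open>Transposed matrices act as adjoints in dual coordinates: entry \<open>j\<close> on both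
  sides is \<open>lam (k (e j) * y)\<close>.\<close>

lemma transpose_matrix_of_mult:
  assumes "\<And>x. lam (k x * y) = lam (x * z)"
  shows "transpose (matrix_of \<iota> e k) *v dual y = dual z"
proof -
  have "lam (k (e j) * y) = (\<Sum>i\<in>UNIV. coords (k (e j)) $ i * lam (e i * y))" for j
    using functional_of_coords[of "\<lambda>x. lam (x * y)" "coords (k (e j))"]
    by (simp add: distrib_right mult.assoc lam_add lam_scale)
  then show ?thesis
    by (simp add: vec_eq_iff matrix_vector_mult_def transpose_def matrix_of_nth dual_def assms)
qed

section \<open>From matrix equivalence to composition of maps\<close>

text \<open>Serves both kinds of equivalence: \<open>\<theta>\<close> is \<open>coords\<close> with
  \<open>T k\<close> the matrix of \<open>k\<close>, or \<open>dual\<close> with \<open>T k\<close>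
  the transposed matrix and \<open>adj k\<close> the adjoint. The automorphism
  \<open>\<sigma>\<close> is absorbed into \<open>P\<close> and \<open>Q\<close>, for which only
  additivity is claimed.\<close>

lemma equivalence_as_maps:
  fixes \<theta> :: "'a \<Rightarrow> 'k^'m" and T :: "'i \<Rightarrow> 'k^'m^'m"
  assumes \<theta>: "bij \<theta>" "\<And>x y. \<theta> (x + y) = \<theta> x + \<theta> y"
    and T: "\<And>k y. k \<in> C \<Longrightarrow> T k *v \<theta> y = \<theta> (adj k y)"
    and lin: "\<And>k. k \<in> D \<Longrightarrow> k_linear k"
    and AB: "invertible A" "invertible B" and \<sigma>: "field_automorphism \<sigma>"
    and eq: "{A ** map_matrix \<sigma> M ** B | M. M \<in> T ` C} = matrix_of \<iota> e ` D"
  obtains P Q where "bij P" "bij Q" "\<And>x y. P (x + y) = P x + P y" "\<And>x y. Q (x + y) = Q x + Q y"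
    "(\<lambda>k. P \<circ> k \<circ> Q) ` (adj ` C) = D"
proof -
  have hom: "field_hom \<sigma>" and bij: "bij \<sigma>"
    using \<sigma> by (auto simp: field_automorphism_def)
  define P where "P = of_coords \<circ> (*v) A \<circ> map_vec \<sigma> \<circ> \<theta>"
  define R where "R = map_vec \<sigma> \<circ> \<theta>"
  \<comment> \<open>Chosen so that \<open>R (Q x) = B *v coords x\<close>: coordinates enter through
    \<open>coords\<close> and leave through \<open>R\<close>, which matches the input side of
    \<open>P\<close>.\<close>
  define Q where "Q = inv R \<circ> (*v) B \<circ> coords"
  have R: "bij R"
    unfolding R_def by (intro bij_comp \<theta> bij_map_vec bij)
  have bP: "bij P"
    unfolding P_def by (intro bij_comp \<theta> bij_map_vec bij bij_matrix_mult AB bij_of_coords)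
  have bQ: "bij Q"
    unfolding Q_def by (intro bij_comp bij_imp_bij_inv R bij_matrix_mult AB bij_coords)
  have R_add: "R (x + y) = R x + R y" for x y
    using hom by (simp add: R_def map_vec_def \<theta>(2) field_hom_def vec_eq_iff)
  have P_add: "P (x + y) = P x + P y" for x y
    using R_add[of x y] by (simp add: P_def R_def of_coords_add matrix_vector_right_distrib)
  have RQ: "R (Q x) = B *v coords x" for x
    using R by (simp add: Q_def bij_is_surj surj_f_inv_f)
  have Q_add: "Q (x + y) = Q x + Q y" for x y
    using bij_is_inj[OF R] by (rule injD) (simp add: R_add RQ coords_add matrix_vector_right_distrib)
  have key: "(A ** map_matrix \<sigma> (T k) ** B) *v coords x = coords (P (adj k (Q x)))" if "k \<in> C" for k x
  proof -
    have "(A ** map_matrix \<sigma> (T k) ** B) *v coords x = A *v (map_matrix \<sigma> (T k) *v R (Q x))"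
      by (simp add: RQ matrix_vector_mul_assoc matrix_mul_assoc)
    also have "\<dots> = A *v R (adj k (Q x))"
      using T[OF that] by (simp add: R_def map_vec_mult[OF hom, symmetric])
    finally show ?thesis
      by (simp add: P_def R_def)
  qed
  have match: "P \<circ> adj k \<circ> Q = g" if "k \<in> C" "g \<in> D" "A ** map_matrix \<sigma> (T k) ** B = matrix_of \<iota> e g" for k g
  proof
    fix x
    have "coords (P (adj k (Q x))) = coords (g x)"
      using key[OF that(1), of x] that(3) matrix_of_mult[OF lin[OF that(2)]] by simp
    then show "(P \<circ> adj k \<circ> Q) x = g x"
      using bij_coords by (simp add: bij_is_inj inj_eq)
  qed
  have "(\<lambda>k. P \<circ> k \<circ> Q) ` (adj ` C) = D"
  proof safe
    fix k assume k: "k \<in> C"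
    then have "A ** map_matrix \<sigma> (T k) ** B \<in> matrix_of \<iota> e ` D"
      unfolding eq[symmetric] by blast
    then obtain g where "g \<in> D" "A ** map_matrix \<sigma> (T k) ** B = matrix_of \<iota> e g"
      by blast
    then show "P \<circ> adj k \<circ> Q \<in> D"
      using match[OF k] by simp
  next
    fix g assume g: "g \<in> D"
    then have "matrix_of \<iota> e g \<in> {A ** map_matrix \<sigma> M ** B | M. M \<in> T ` C}"
      unfolding eq by blast
    then obtain k where "k \<in> C" "A ** map_matrix \<sigma> (T k) ** B = matrix_of \<iota> e g"
      by auto
    then show "g \<in> (\<lambda>k. P \<circ> k \<circ> Q) ` (adj ` C)"
      using match[OF _ g] by blast
  qed
  then show ?thesis
    by (rule that[OF bP bQ P_add Q_add])
qed

lemma k_linear_H2: "k \<in> H2_code q t \<mu> h \<Longrightarrow> k_linear k"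
  by (auto simp: H2_code_def k_linear_def frob_add power_mult_distrib \<iota>_frob algebra_simps)

lemma k_linear_U: "k \<in> U_code q n b s \<Longrightarrow> k_linear k"
  by (auto simp: U_code_def k_linear_def frob_add power_mult_distrib \<iota>_frob algebra_simps)

lemma U_code_not_equivalent_H2:
  assumes n: "n > 2" and m: "m = 2 * n" and t: "coprime t m" and b: "b \<noteq> 0"
  shows "\<not> codes_equivalent (matrix_of \<iota> e ` U_code q n b s) (matrix_of \<iota> e ` H2_code q t \<mu> h)"
proof
  let ?C = "U_code q n b s" and ?H = "H2_code q t \<mu> h"
  assume "codes_equivalent (matrix_of \<iota> e ` ?C) (matrix_of \<iota> e ` ?H)"
  then obtain A B :: "'k^'m^'m" and \<sigma> where AB: "invertible A" "invertible B" "field_automorphism \<sigma>"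
    and "{A ** map_matrix \<sigma> M ** B | M. M \<in> matrix_of \<iota> e ` ?C} = matrix_of \<iota> e ` ?H \<or>
      {A ** map_matrix \<sigma> (transpose M) ** B | M. M \<in> matrix_of \<iota> e ` ?C} = matrix_of \<iota> e ` ?H"
    unfolding codes_equivalent_def by blast
  then show False
  proof (elim disjE)
    assume eq: "{A ** map_matrix \<sigma> M ** B | M. M \<in> matrix_of \<iota> e ` ?C} = matrix_of \<iota> e ` ?H"
    obtain P Q where PQ: "bij P" "bij Q" "\<And>x y. P (x + y) = P x + P y"
      "(\<lambda>k. P \<circ> k \<circ> Q) ` (id ` ?C) = ?H"
      by (rule equivalence_as_maps[where T = "matrix_of \<iota> e" and adj = id, OF bij_coords coords_add _ k_linear_H2 AB eq])
        (auto simp: matrix_of_mult k_linear_U)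
    show False
      using left_linear_code_not_H2[OF n m t, of "\<lambda>x. b * x ^ (q ^ s) + x ^ (q ^ (s + n))" b s 1 ?C P Q \<mu> h] PQ b
      by (simp add: U_code_def)
  next
    assume eq: "{A ** map_matrix \<sigma> (transpose M) ** B | M. M \<in> matrix_of \<iota> e ` ?C} = matrix_of \<iota> e ` ?H"
    \<comment> \<open>The exponent \<open>r\<close> stands for \<open>- s\<close> modulo
      \<open>m\<close>. As \<open>m = 2 * n\<close>, the exponent opposite to \<open>s + n\<close>
      is \<open>r + n\<close>, so the adjoint again has two exponents differing by
      \<open>n\<close>.\<close>
    define r where "r = (m - 1) * s"
    have "s + r = m * s" "(s + n) + (r + n) = m * (s + 1)"
      using pred_steps(2)[of s] m by (auto simp: r_def)
    then have "[s + r = 0] (mod m)" "[(s + n) + (r + n) = 0] (mod m)"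
      by (simp_all only: cong_mult_self_left)
    then obtain c d where cd: "c \<noteq> 0" "d \<noteq> 0"
      "\<And>x y. lam (x ^ (q ^ s) * y) = lam (x * (c * y ^ (q ^ r)))"
      "\<And>x y. lam (x ^ (q ^ (s + n)) * y) = lam (x * (d * y ^ (q ^ (r + n))))"
      by (metis frob_adjoint)
    \<comment> \<open>The adjoint of the binomial; \<open>b\<close> is raised to
      \<open>q ^ r\<close> because it multiplies \<open>y\<close> before the adjoint power is
      taken.\<close>
    define f where "f x = (c * b ^ (q ^ r)) * x ^ (q ^ r) + d * x ^ (q ^ (r + n))" for x
    define k where "k a = (\<lambda>x. snd a * (b * x ^ (q ^ s) + x ^ (q ^ (s + n))) + fst a * x)" for a :: "'a \<times> 'a"
    define k' where "k' a = (\<lambda>y. f (snd a * y) + fst a * y)" for a :: "'a \<times> 'a"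
    have C: "?C = range k"
      using range_pair[of k] by (simp add: U_code_def k_def)
    have "lam (k a x * y) = lam (x * k' a y)" for a x y
      using cd(3)[of x "snd a * b * y"] cd(4)[of x "snd a * y"]
      by (simp add: k_def k'_def f_def lam_add distrib_left distrib_right power_mult_distrib ac_simps)
    note T = transpose_matrix_of_mult[of "k a" _ "k' a _" for a, OF this]
    have eq': "{A ** map_matrix \<sigma> M ** B | M. M \<in> range (\<lambda>a. transpose (matrix_of \<iota> e (k a)))} = matrix_of \<iota> e ` ?H"
      unfolding eq[symmetric] C by blast
    obtain P Q where PQ: "bij P" "bij Q" "\<And>x y. P (x + y) = P x + P y" "\<And>x y. Q (x + y) = Q x + Q y"
      "(\<lambda>k. P \<circ> k \<circ> Q) ` range k' = ?H"
      by (rule equivalence_as_maps[OF bij_dual dual_add T k_linear_H2 AB eq']) blast+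
    have "range k' = {\<lambda>x. f (a1 * x) + a0 * x | a0 a1. True}"
      using range_pair[of k'] by (simp add: k'_def)
    then show False
      using right_linear_code_not_H2[OF n m t f_def _ cd(2) _ PQ(1,2,4)] cd(1) b PQ(5) by simp
  qed
qed

end

section \<open>Parameters of the code\<close>

text \<open>Linear combinations of a basis \<open>B\<close> match the subspace with the coefficient
  functions on \<open>B\<close>, taken extensional so that their values on \<open>B\<close>
  determine them.\<close>

lemma card_subspace:
  fixes scale :: "'k::{field,finite} \<Rightarrow> 'v::ab_group_add \<Rightarrow> 'v"
  assumes "vector_space scale" and S: "module.subspace scale S" "finite S"
  shows "card S = CARD('k) ^ vector_space.dim scale S"
proof -
  interpret vector_space scale by fact
  obtain B where B: "B \<subseteq> S" "independent B" "S \<subseteq> span B" "card B = dim S"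
    using basis_exists by blast
  have fin: "finite B"
    using B(1) S(2) finite_subset by blast
  define g where "g u = (\<Sum>v\<in>B. scale (u v) v)" for u
  have inj: "inj_on g (B \<rightarrow>\<^sub>E UNIV)"
  proof (rule inj_onI)
    fix u w assume u: "u \<in> B \<rightarrow>\<^sub>E UNIV" and w: "w \<in> B \<rightarrow>\<^sub>E UNIV" and eq: "g u = g w"
    have "(\<Sum>v\<in>B. scale (u v - w v) v) = 0"
      using eq by (simp add: g_def scale_left_diff_distrib sum_subtractf)
    then have "\<forall>v\<in>B. u v - w v = 0"
      using B(2) by (auto simp: dependent_finite[OF fin] dest!: spec[of _ "\<lambda>v. u v - w v"])
    then show "u = w"
      by (intro PiE_ext[OF u w]) auto
  qed
  have "g ` (B \<rightarrow>\<^sub>E UNIV) = span B"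
  proof -
    have "g u \<in> g ` (B \<rightarrow>\<^sub>E UNIV)" for u
      by (rule image_eqI[where x = "restrict u B"]) (auto simp: g_def)
    then show ?thesis
      unfolding span_finite[OF fin] g_def by auto
  qed
  moreover have "span B = S"
    using B span_minimal[OF B(1) S(1)] by blast
  ultimately have "card S = card (B \<rightarrow>\<^sub>E (UNIV :: 'k set))"
    using card_image[OF inj] by simp
  then show ?thesis
    by (simp add: card_PiE fin B(4))
qed

text \<open>Each fibre, translated by one of its points, embeds in \<open>K\<close>, and at most
  \<open>card X\<close> fibres are nonempty.\<close>

lemma card_le_card_image_times_fibre:
  fixes g :: "'v::{ab_group_add,finite} \<Rightarrow> 'x"
  assumes "finite X" and g: "range g \<subseteq> X" and K: "\<And>u v. g u = g v \<Longrightarrow> u - v \<in> K"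
  shows "CARD('v) \<le> card X * card K"
proof -
  have "card {v. g v = y} \<le> card K" for y
  proof (cases "\<exists>u. g u = y")
    case True
    then obtain u where "g u = y" ..
    then have "(\<lambda>v. v - u) ` {v. g v = y} \<subseteq> K"
      using K by auto
    then show ?thesis
      by (intro card_inj_on_le[where f = "\<lambda>v. v - u"]) (auto simp: inj_on_def)
  qed simp
  then have "(\<Sum>y\<in>X. card {v. g v = y}) \<le> (\<Sum>y\<in>X. card K)"
    by (rule sum_mono)
  moreover have "(UNIV :: 'v set) = (\<Union>y\<in>X. {v. g v = y})"
    using g by auto
  then have "CARD('v) \<le> (\<Sum>y\<in>X. card {v. g v = y})"
    by (metis card_UN_le \<open>finite X\<close>)
  ultimately show ?thesis
    by simp
qed

text \<open>The library defines \<open>rank\<close> by rows and equates it with the column rank only over the reals.\<close>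
lemma rank_lower_bound:
  fixes M :: "'k::{field,finite}^'m^'m"
  shows "CARD('k^'m) \<le> CARD('k) ^ rank M * card {v. M *v v = 0}"
proof -
  define dot where "dot b v = (\<Sum>i\<in>UNIV. b $ i * v $ i)" for b v :: "'k^'m"
  obtain B where B: "B \<subseteq> rows M" "vec.independent B" "rows M \<subseteq> vec.span B" "card B = vec.dim (rows M)"
    using vec.basis_exists by blast
  \<comment> \<open>A vector is sent to its products with a basis of the row space. Two vectors with
    equal images differ by one orthogonal to all rows, that is, by a kernel vector.\<close>
  have "CARD('k^'m) \<le> card (B \<rightarrow>\<^sub>E (UNIV :: 'k set)) * card {v. M *v v = 0}"
  proof (rule card_le_card_image_times_fibre[where g = "\<lambda>v. restrict (\<lambda>b. dot b v) B"])
    fix u v assume "restrict (\<lambda>b. dot b u) B = restrict (\<lambda>b. dot b v) B"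
    then have "dot b u = dot b v" if "b \<in> B" for b
      using that by (metis restrict_apply')
    then have "B \<subseteq> {b. dot b (u - v) = 0}"
      by (auto simp: dot_def right_diff_distrib sum_subtractf)
    moreover have "vec.subspace {b. dot b (u - v) = 0}"
      by (rule vec.subspaceI)
        (auto simp: dot_def distrib_right sum.distrib mult.assoc simp flip: sum_distrib_left)
    ultimately have "vec.span B \<subseteq> {b. dot b (u - v) = 0}"
      by (rule vec.span_minimal)
    then have "dot (row i M) (u - v) = 0" for i
      using B(3) by (auto simp: rows_def)
    then show "u - v \<in> {v. M *v v = 0}"
      by (simp add: vec_eq_iff matrix_vector_mult_def dot_def row_def)
  qed (auto simp: finite_PiE)
  then show ?thesis
    by (simp add: card_PiE B(4) row_rank_def_gen)
qed

text \<open>Full rank would make the rows span the space, giving a left inverse and hence a trivial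
  kernel.\<close>

lemma rank_less_if_kernel:
  fixes M :: "'k::field^'m^'m"
  assumes "M *v v = 0" "v \<noteq> 0"
  shows "rank M < CARD('m)"
proof (rule ccontr)
  assume "\<not> rank M < CARD('m)"
  then have "vec.dim (rows M) = vec.dim (UNIV :: ('k^'m) set)"
    using vec.dim_subset_UNIV[of "rows M"] by (simp add: row_rank_def_gen vec.dimension_def card_cart_basis)
  then have "vec.span (rows M) = UNIV"
    using vec.dim_eq_full[of "rows M"] by (simp add: vec.dimension_def)
  then show False
    using assms matrix_left_invertible_span_rows_gen[of M] matrix_left_invertible_ker[of M] by metis
qed

section \<open>Ranks and distances of codewords\<close>

context field_extension
begin

lemma coords_diff: "coords (x - y) = coords x - coords y"
  using coords_add[of "x - y" y] by simp

lemma matrix_of_diff: "matrix_of \<iota> e (\<lambda>x. f x - g x) = matrix_of \<iota> e f - matrix_of \<iota> e g"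
  by (simp add: vec_eq_iff matrix_of_nth coords_diff)

lemma matrix_of_add: "matrix_of \<iota> e (\<lambda>x. f x + g x) = matrix_of \<iota> e f + matrix_of \<iota> e g"
  by (simp add: vec_eq_iff matrix_of_nth coords_add)

lemma matrix_of_scale: "matrix_of \<iota> e (\<lambda>x. \<iota> c * f x) = matrix_scale c (matrix_of \<iota> e f)"
  by (simp add: vec_eq_iff matrix_of_nth coords_scale matrix_scale_def)

lemma matrix_of_zero: "matrix_of \<iota> e (\<lambda>x. 0) = 0"
  by (simp add: vec_eq_iff matrix_of_nth)

lemma card_base_vec: "CARD('k^'m) = q ^ m"
  using bij_betw_same_card[OF bij_coords] unfolding card_field by (rule sym)

lemma kernel_matrix_of:
  assumes "k_linear f"
  shows "{v. matrix_of \<iota> e f *v v = 0} = coords ` {x. f x = 0}"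
proof -
  have *: "matrix_of \<iota> e f *v coords x = 0 \<longleftrightarrow> f x = 0" for x
    using matrix_of_mult[OF assms, of x] inj_eq[OF bij_is_inj[OF bij_coords], of "f x" 0] by simp
  show ?thesis
  proof (intro equalityI subsetI)
    fix v assume "v \<in> {v. matrix_of \<iota> e f *v v = 0}"
    then have "f (of_coords v) = 0"
      using *[of "of_coords v"] by simp
    then show "v \<in> coords ` {x. f x = 0}"
      by (intro image_eqI[of _ _ "of_coords v"]) auto
  qed (use * in auto)
qed

lemma rank_matrix_of_ge:
  assumes "k_linear f" "card {x. f x = 0} \<le> q"
  shows "m - 1 \<le> rank (matrix_of \<iota> e f)"
proof -
  let ?K = "{v. matrix_of \<iota> e f *v v = 0}" and ?r = "rank (matrix_of \<iota> e f)"
  have "card ?K \<le> q"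
    unfolding kernel_matrix_of[OF assms(1)] by (rule order_trans[OF card_image_le assms(2)]) simp
  have "q ^ m \<le> q ^ ?r * card ?K"
    using rank_lower_bound[of "matrix_of \<iota> e f"] unfolding card_base_vec card_base .
  also have "\<dots> \<le> q ^ ?r * q"
    using \<open>card ?K \<le> q\<close> by (rule mult_le_mono2)
  finally have "q ^ m \<le> q ^ Suc ?r"
    by (simp only: power_Suc mult.commute)
  then have "m \<le> Suc ?r"
    by (rule power_le_imp_le_exp[OF q_gt_1])
  then show ?thesis
    by simp
qed

definition U_map :: "nat \<Rightarrow> 'a \<Rightarrow> nat \<Rightarrow> 'a \<times> 'a \<Rightarrow> 'a \<Rightarrow> 'a" where
  "U_map n b s a x = snd a * (b * x ^ (q ^ s) + x ^ (q ^ (s + n))) + fst a * x"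

lemma U_code_eq: "U_code q n b s = range (U_map n b s)"
  using range_pair[of "U_map n b s"] by (simp add: U_code_def U_map_def[abs_def])

lemma k_linear_U_map: "k_linear (U_map n b s a)"
  by (rule k_linear_U[of _ n b s]) (simp add: U_code_eq)

lemma U_map_add: "U_map n b s (a + a') x = U_map n b s a x + U_map n b s a' x"
  and U_map_diff: "U_map n b s (a - a') x = U_map n b s a x - U_map n b s a' x"
  and U_map_scale: "U_map n b s (pair_scale \<iota> c a) x = \<iota> c * U_map n b s a x"
  by (simp_all add: U_map_def pair_scale_def algebra_simps)

text \<open>If \<open>snd a \<noteq> 0\<close>, a zero \<open>x\<close> corresponds to a point of
  \<open>U_space\<close> on the line through \<open>(1, - fst a / snd a)\<close>. Scatteredness
  bounds that intersection by dimension 1, hence by \<open>q\<close> points. Otherwise the codeword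
  is a nonzero scalar multiplication.\<close>

lemma card_kernel_U_map:
  assumes scattered: "scattered \<iota> (U_space q n b s)" and a: "a \<noteq> 0"
  shows "card {x. U_map n b s a x = 0} \<le> q"
proof (cases "snd a = 0")
  case True
  then have "fst a \<noteq> 0"
    using a by (simp add: prod_eq_iff)
  then have "{x. U_map n b s a x = 0} = {0}"
    using True by (auto simp: U_map_def)
  then show ?thesis
    using q_gt_1 by simp
next
  case False
  interpret pair: vector_space "pair_scale \<iota>"
    by (rule vector_space_pair_scale[OF hom])
  interpret pair': vector_space "pair_scale (\<lambda>c::'a. c)"
    by (rule vector_space_pair_scale) (simp add: field_hom_def)
  define v where "v = (1 :: 'a, - fst a / snd a)"
  define S where "S = pair'.span {v} \<inter> U_space q n b s"
  have S: "pair.subspace S" "pair.dim S \<le> 1"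
  proof -
    have "pair.subspace (pair'.span {v})"
    proof (rule pair.subspaceI)
      fix c w assume "w \<in> pair'.span {v}"
      then have "pair_scale (\<lambda>c. c) (\<iota> c) w \<in> pair'.span {v}"
        by (rule pair'.span_scale)
      then show "pair_scale \<iota> c w \<in> pair'.span {v}"
        by (simp add: pair_scale_def)
    qed (auto intro: pair'.span_zero pair'.span_add)
    then show "pair.subspace S"
      using scattered unfolding S_def scattered_def by (intro pair.subspace_inter) auto
    show "pair.dim S \<le> 1"
      using scattered unfolding S_def scattered_def by (auto simp: v_def)
  qed
  have "card S \<le> q"
    using card_subspace[OF pair.vector_space_axioms S(1)] S(2) power_increasing[OF S(2), of q] q_gt_1
    by (simp add: card_base)
  moreover have "card {x. U_map n b s a x = 0} \<le> card S"
  proof (rule card_inj_on_le)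
    let ?g = "\<lambda>x. (x, b * x ^ (q ^ s) + x ^ (q ^ (s + n)))"
    show "inj_on ?g {x. U_map n b s a x = 0}"
      by (simp add: inj_on_def)
    show "?g ` {x. U_map n b s a x = 0} \<subseteq> S"
    proof safe
      fix x assume "U_map n b s a x = 0"
      then have "snd a * (b * x ^ (q ^ s) + x ^ (q ^ (s + n))) = - (fst a * x)"
        by (simp add: U_map_def eq_neg_iff_add_eq_0)
      then have "b * x ^ (q ^ s) + x ^ (q ^ (s + n)) = - (fst a * x) / snd a"
        using False by (metis nonzero_mult_div_cancel_left)
      then have "?g x = pair_scale (\<lambda>c. c) x v"
        by (simp add: pair_scale_def v_def mult.commute)
      then have "?g x \<in> pair'.span {v}"
        by (simp add: pair'.span_base pair'.span_scale)
      then show "?g x \<in> S"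
        unfolding S_def U_space_def by blast
    qed
  qed simp
  ultimately show ?thesis
    by linarith
qed

lemma U_code_parameters:
  assumes m: "m > 1" "CARD('m) = m" and scattered: "scattered \<iota> (U_space q n b s)"
  defines "D \<equiv> matrix_of \<iota> e ` U_code q n b s"
  shows "linear_code D" "card D = q ^ (2 * m)" "code_dim D = 2 * m" "min_distance D = m - 1"
proof -
  interpret mat: vector_space "matrix_scale :: 'k \<Rightarrow> 'k^'m^'m \<Rightarrow> 'k^'m^'m"
    by (rule vector_space_matrix_scale)
  define T where "T a = matrix_of \<iota> e (U_map n b s a)" for a
  have D: "D = range T"
    by (simp add: D_def U_code_eq T_def image_image)
  have "U_map n b s (a + a') = (\<lambda>x. U_map n b s a x + U_map n b s a' x)"
    "U_map n b s (a - a') = (\<lambda>x. U_map n b s a x - U_map n b s a' x)"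
    "U_map n b s (pair_scale \<iota> c a) = (\<lambda>x. \<iota> c * U_map n b s a x)"
    "U_map n b s 0 = (\<lambda>x. 0)" for a a' c
    by (simp_all add: U_map_add U_map_diff U_map_scale fun_eq_iff) (simp add: U_map_def)
  then have T_add: "T a + T a' = T (a + a')" and T_diff: "T a - T a' = T (a - a')"
    and T_scale: "matrix_scale c (T a) = T (pair_scale \<iota> c a)" and T_0: "T 0 = 0" for a a' c
    by (simp_all add: T_def matrix_of_add matrix_of_diff matrix_of_scale matrix_of_zero)
  have sub: "mat.subspace D"
  proof (rule mat.subspaceI)
    show "0 \<in> D"
      using T_0 unfolding D by (metis rangeI)
  qed (auto simp: D T_add T_scale)
  then show "linear_code D"
    by (simp add: linear_code_def)
  have rank_ge: "m - 1 \<le> rank (T a)" if "a \<noteq> 0" for a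
    unfolding T_def by (intro rank_matrix_of_ge k_linear_U_map card_kernel_U_map scattered that)
  have rank_0: "rank (0 :: 'k^'m^'m) = 0"
    by (auto simp: row_rank_def_gen vec.dim_eq_0 rows_def row_def vec_eq_iff)
  \<comment> \<open>The rank bound \<open>m - 1\<close> is positive, so \<open>T\<close> kills no
    nonzero pair and is injective.\<close>
  then have T_nz: "T a \<noteq> 0" if "a \<noteq> 0" for a
    using rank_ge[OF that] m by auto
  have "inj T"
    proof (rule injI)
    fix a a' assume "T a = T a'"
    then have "T (a - a') = 0"
      by (simp flip: T_diff)
    then show "a = a'"
      using T_nz[of "a - a'"] by auto
  qed
  then show card: "card D = q ^ (2 * m)"
    by (simp add: D card_image card_field power_add mult_2 flip: UNIV_Times_UNIV)
  have "q ^ (2 * m) = q ^ mat.dim D"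
    using card_subspace[OF vector_space_matrix_scale sub] card by (simp add: card_base)
  then show "code_dim D = 2 * m"
    using q_gt_1 by (simp add: code_dim_def)
  let ?R = "{rank_distance A B | A B. A \<in> D \<and> B \<in> D \<and> A \<noteq> B}"
  have "?R = (\<lambda>(A, B). rank_distance A B) ` {(A, B). A \<in> D \<and> B \<in> D \<and> A \<noteq> B}"
    by auto
  then have "finite ?R"
    by simp
  moreover have "m - 1 \<le> d" if d: "d \<in> ?R" for d
  proof -
    obtain A A' where "A \<in> D" "A' \<in> D" "A \<noteq> A'" "d = rank_distance A A'"
      using d by blast
    then obtain a a' where "T a \<noteq> T a'" "d = rank (T a - T a')"
      unfolding D rank_distance_def by blast
    moreover from this have "a - a' \<noteq> 0"
      by auto
    ultimately show ?thesis
      using rank_ge by (simp add: T_diff)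
  qed
  moreover have "m - 1 \<in> ?R"
  proof -
    \<comment> \<open>The binomial takes the value \<open>b + 1\<close> at 1, so this codeword
      vanishes there and its rank is exactly \<open>m - 1\<close>.\<close>
    define a where "a = (- (b + 1), 1 :: 'a)"
    have a: "a \<noteq> 0"
      by (simp add: a_def zero_prod_def)
    have "T a *v coords 1 = coords (U_map n b s a 1)"
      unfolding T_def by (rule matrix_of_mult[OF k_linear_U_map])
    then have "T a *v coords 1 = 0"
      by (simp add: U_map_def a_def)
    moreover have "coords 1 \<noteq> 0"
      by (metis coords_0 of_coords_coords zero_neq_one)
    ultimately have "rank (T a) < m"
      using rank_less_if_kernel m(2) by metis
    then have "rank_distance (T a) 0 = m - 1"
      using rank_ge[OF a] by (simp add: rank_distance_def)
    moreover have "T a \<in> D" "0 \<in> D" "T a \<noteq> 0"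
      using T_nz[OF a] mat.subspace_0[OF sub] by (auto simp: D)
    ultimately show ?thesis
      by (intro CollectI) metis
  qed
  ultimately show "min_distance D = m - 1"
    unfolding min_distance_def by (rule Min_eqI)
qed

end

section \<open>Parameters and inequivalence combined\<close>

theorem theorem6p4:
  fixes \<iota> :: "'k::{field,finite} \<Rightarrow> 'a::{field,finite}"
    and e :: "'m::finite \<Rightarrow> 'a"
    and q n s :: nat
    and b :: 'a
  assumes "primepow q" and "n > 2"
    and "CARD('k) = q" and "CARD('a) = q ^ (2 * n)" and "CARD('m) = 2 * n"
    and "field_hom \<iota>" and "is_basis \<iota> e"
    and "b \<noteq> 0"
    and "1 \<le> s" and "s \<le> 2 * n - 1" and "gcd s n = 1"
    and "finite_field_norm (q ^ n) 2 b \<noteq> 1"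
    and "scattered \<iota> (U_space q n b s)"
  shows "linear_code (matrix_of \<iota> e ` U_code q n b s) \<and>
         code_dim (matrix_of \<iota> e ` U_code q n b s) = 4 * n \<and>
         min_distance (matrix_of \<iota> e ` U_code q n b s) = 2 * n - 1 \<and>
         MRD_code (matrix_of \<iota> e ` U_code q n b s) \<and>
         (\<forall>t h \<mu>. gcd t (2 * n) = 1 \<and> finite_field_norm (q ^ t) (2 * n) \<mu> \<noteq> 1 \<longrightarrow>
            \<not> codes_equivalent (matrix_of \<iota> e ` U_code q n b s) (matrix_of \<iota> e ` H2_code q t \<mu> h))"
proof -
  interpret field_extension q "2 * n" "TYPE('a)" \<iota> e
    using assms by unfold_locales
  have "2 * n > 1"
    using assms(2) by simp
  note parameters = U_code_parameters[OF this assms(5) assms(13)]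
  \<comment> \<open>For matrices of size \<open>2 * n\<close> and distance \<open>2 * n - 1\<close>
    the exponent in the MRD condition is \<open>2 * n * 2\<close>, which agrees with the cardinality
    already counted.\<close>
  have "MRD_code (matrix_of \<iota> e ` U_code q n b s)"
    unfolding MRD_code_def parameters(2,4) using assms(2,3,5) by (simp add: mult.commute)
  moreover have "\<not> codes_equivalent (matrix_of \<iota> e ` U_code q n b s) (matrix_of \<iota> e ` H2_code q t \<mu> h)"
    if "gcd t (2 * n) = 1" for t h \<mu>
    by (rule U_code_not_equivalent_H2[OF assms(2) refl _ assms(8)]) (simp only: coprime_iff_gcd_eq_1 that)
  ultimately show ?thesis
    using parameters(1,3,4) by simp
qed

end
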